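(* Let $\sigma_2,\sigma_3,\ldots$ be chip configurations, $\sigma_n$ on the complete graph $K_n$, such that $0\le \sigma_n(v)\le n-1$ for all $v\in[n]$, and suppose there is a continuous function $F:[0,1]\to[0,1]$ such that for every $x\in[0,1]$, \[ \frac1n\#\{v\in[n] : \sigma_n(v)<nx\}\to F(x)\quad\text{as } n\to\infty. \] Define $\Phi:\mathbb{R}\to\mathbb{R}$ by $\Phi(x)=\lceil x\rceil - F(\lceil x\rceil - x)$ and $R_y(x)=x+y$. Then for each $y\in[0,1]$, \[ s_n(y)\to s(y):=\rho(R_y\circ\Phi)\quad\text{as } n\to\infty, \] where $s_n(y)=a(\sigma_n+ny)$ is the rescaled activity phase diagram and $\rho$ denotes the Poincaré rotation number.
   Context: Parallel chip-firing on $K_n$: a chip configuration is $\sigma:[n]\to\mathbb{Z}_{\ge0}$, $[n]=\{1,\dots,n\}$. Generalized chip configurations: a measurable $\eta:[0,1]\to[0,\infty)$; let $r(\eta)=\mathcal{L}\{x:\eta(x)\ge1\}$ ($\mathcal{L}$ = Lebesgue measure) and define the update $U\eta(x)=\eta(x)+r(\eta)$ if $\eta(x)<1$, $U\eta(x)=\eta(x)-1+r(\eta)$ if $\eta(x)\ge1$; $U^t$ denotes the $t$-fold iterate. Let $\beta_t=\sum_{s=0}^{t-1}r(U^s\eta)$ and the activity $a(\eta)=\lim_{t\to\infty}\beta_t/t$. To a chip configuration $\sigma$ on $K_n$ associate the generalized configuration $\psi(\sigma)(x)=\frac{\sigma(\lceil nx\rceil)+\lceil nx\rceil-nx}{n}$.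 For $y\in[0,1]$, $\sigma_n+ny$ denotes the generalized chip configuration $\psi(\sigma_n)+y$ (when $ny$ is an integer this is $\psi$ of the configuration obtained by adding $ny$ chips to each vertex, and its activity equals the usual chip-firing activity $\lim_t \frac{1}{nt}\sum_{s<t}\#\{v: U^s\sigma(v)\ge n\}$), and $a(\sigma_n+ny)$ is its activity. For a continuous nondecreasing $f:\mathbb{R}\to\mathbb{R}$ with $f(x+1)=f(x)+1$, the rotation number is $\rho(f)=\lim_{t\to\infty}f^t(x)/t$ (independent of $x$). *)

theory Defs
  imports "HOL-Analysis.Analysis"
begin

text \<open>
  A generalized chip configuration \<open>\<eta> : [0,1] \<rightarrow> [0,\<infinity>)\<close> is represented by a function
  \<open>real \<Rightarrow> real\<close>; the firing measure, and hence everything derived from it except the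
  pointwise update, only looks at the values of \<open>\<eta>\<close> on \<open>{0..1}\<close>.
\<close>

definition firing_measure :: "(real \<Rightarrow> real) \<Rightarrow> real" where
  "firing_measure \<eta> = measure lebesgue {x \<in> {0..1}. \<eta> x \<ge> 1}"

definition chip_update :: "(real \<Rightarrow> real) \<Rightarrow> real \<Rightarrow> real" where
  "chip_update \<eta> x =
     (if \<eta> x < 1 then \<eta> x + firing_measure \<eta> else \<eta> x - 1 + firing_measure \<eta>)"

definition total_firing :: "(real \<Rightarrow> real) \<Rightarrow> nat \<Rightarrow> real" where
  "total_firing \<eta> t = (\<Sum>s<t. firing_measure ((chip_update ^^ s) \<eta>))"

definition activity :: "(real \<Rightarrow> real) \<Rightarrow> real" where
  "activity \<eta> = lim (\<lambda>t. total_firing \<eta> t / real t)"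

text \<open>
  A chip configuration on \<open>K\<^sub>n\<close> is a function \<open>nat \<Rightarrow> nat\<close> of which only the values on the
  vertex set \<open>{1..n}\<close> are meaningful. At \<open>x = 0\<close> the formula below reads off the value at the
  non-vertex \<open>0\<close>; this affects a single point and hence no firing measure.
\<close>

definition gen_of_config :: "nat \<Rightarrow> (nat \<Rightarrow> nat) \<Rightarrow> real \<Rightarrow> real" where
  "gen_of_config n \<sigma> x =
     (real (\<sigma> (nat \<lceil>real n * x\<rceil>)) + of_int \<lceil>real n * x\<rceil> - real n * x) / real n"

definition activity_diagram :: "nat \<Rightarrow> (nat \<Rightarrow> nat) \<Rightarrow> real \<Rightarrow> real" where
  "activity_diagram n \<sigma> y = activity (\<lambda>x. gen_of_config n \<sigma> x + y)"

definition lift_map :: "(real \<Rightarrow> real) \<Rightarrow> real \<Rightarrow> real" where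
  "lift_map F x = of_int \<lceil>x\<rceil> - F (of_int \<lceil>x\<rceil> - x)"

definition translation :: "real \<Rightarrow> real \<Rightarrow> real" where
  "translation y x = x + y"

text \<open>
  The common limit of \<open>f\<^sup>t(x) / t\<close> over all starting points \<open>x\<close>; meaningful for continuous
  nondecreasing \<open>f\<close> with \<open>f (x + 1) = f x + 1\<close>.
\<close>

definition rotation_number :: "(real \<Rightarrow> real) \<Rightarrow> real" where
  "rotation_number f = (THE \<rho>. \<forall>x. (\<lambda>t. (f ^^ t) x / real t) \<longlonglongrightarrow> \<rho>)"

end

theory Submission
  imports Defs
begin

text \<open>
  While \<open>0 \<le> U\<^sup>t\<eta> < 2\<close> holds, the number of times a point \<open>x\<close> has fired by time \<open>t + 1\<close> is
  forced to be \<open>\<lfloor>\<eta> x + \<beta>\<^sub>t\<rfloor>\<close>. Integrating over \<open>x\<close> shows that \<open>\<beta>\<^sub>t + y\<close> is an orbit of the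
  nondecreasing degree-one map \<open>c \<mapsto> y + \<integral> \<lfloor>\<psi> x + c\<rfloor> dx\<close>, so the activity is a rotation number.
  These maps converge pointwise to the continuous map \<open>R\<^sub>y \<circ> \<Phi>\<close>. By monotonicity each fixed
  iterate converges as well, and since \<open>f\<^sup>t x\<close> differs from \<open>x + t \<rho>(f)\<close> by a universal
  constant, the rotation numbers converge.
\<close>

section \<open>Rotation numbers of nondecreasing degree-one maps\<close>

lemma degree_one_of_int:
  fixes f :: "real \<Rightarrow> real"
  assumes "\<And>x. f (x + 1) = f x + 1"
  shows "f (x + of_int k) = f x + of_int k"
proof (induction k rule: int_induct[where k = 0])
  case (step1 i)
  then show ?case using assms[of "x + of_int i"] by (simp add: add.assoc)
next
  case (step2 i)
  then show ?case using assms[of "x + of_int (i - 1)"] by simp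
qed simp

lemma degree_one_funpow:
  fixes f :: "real \<Rightarrow> real"
  assumes "\<And>x. f (x + 1) = f x + 1"
  shows "(f ^^ t) (x + 1) = (f ^^ t) x + 1"
  by (induction t) (simp_all add: assms)

text \<open>With \<open>k = \<lfloor>x - y\<rfloor>\<close>, the point \<open>x\<close> lies between
  \<open>y + k\<close> and \<open>y + k + 1\<close>. Monotonicity and the degree-one property then
  put \<open>f x - f y\<close> into \<open>[k, k + 1]\<close>, the unit interval that also contains
  \<open>x - y\<close>.\<close>

lemma mono_degree_one_displacement:
  fixes f :: "real \<Rightarrow> real"
  assumes "mono f" and "\<And>x. f (x + 1) = f x + 1"
  shows "\<bar>(f x - x) - (f y - y)\<bar> \<le> 1"
proof -
  define k where "k = \<lfloor>x - y\<rfloor>"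
  have k: "y + of_int k \<le> x" "x \<le> y + of_int (k + 1)"
    unfolding k_def by linarith+
  have "f y + of_int k \<le> f x" "f x \<le> f y + of_int (k + 1)"
    using monoD[OF assms(1) k(1)] monoD[OF assms(1) k(2)]
    by (simp_all only: degree_one_of_int[of f, OF assms(2)])
  then show ?thesis using k by simp
qed

text \<open>Both \<open>m * a n\<close> and \<open>n * a m\<close> are close to
  \<open>a (m * n)\<close>, which makes \<open>a n / n\<close> a Cauchy sequence. The bound 1,
  uniform in \<open>n\<close>, comes from comparing \<open>a n\<close> with
  \<open>a (m * n) / m\<close> and letting \<open>m\<close> tend to infinity.\<close>

lemma almost_additive_limit:
  fixes a :: "nat \<Rightarrow> real"
  assumes add: "\<And>m n. \<bar>a (m + n) - a m - a n\<bar> \<le> 1"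
  obtains \<rho> where "\<And>n. \<bar>a n - real n * \<rho>\<bar> \<le> 1"
proof -
  have mult: "\<bar>a (m * n) - real m * a n\<bar> \<le> real m + 1" for m n
  proof (induction m)
    case 0
    then show ?case using add[of 0 0] by simp
  next
    case (Suc m)
    then show ?case using add[of n "m * n"] by (simp add: algebra_simps)
  qed
  have cross: "\<bar>real n * a m - real m * a n\<bar> \<le> real m + real n + 2" for m n
    using mult[of m n] mult[of n m] by (simp add: mult.commute)
  have quot: "\<bar>a m / real m - a n / real n\<bar> \<le> 2 / real m + 2 / real n"
    if "m > 0" "n > 0" for m n
  proof -
    have "\<bar>a m / real m - a n / real n\<bar> = \<bar>real n * a m - real m * a n\<bar> / (real m * real n)"
    proof -
      have "a m / real m - a n / real n = (real n * a m - real m * a n) / (real m * real n)"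
        using that by (simp add: field_simps)
      then show ?thesis by (simp add: abs_mult)
    qed
    \<comment> \<open>Since \<open>m\<close> and \<open>n\<close> are at least 1, the summand 2 of
      \<open>cross\<close> is absorbed by \<open>m + n\<close>.\<close>
    also have "\<dots> \<le> (2 * real m + 2 * real n) / (real m * real n)"
      using cross[of n m] that by (intro divide_right_mono) auto
    also have "\<dots> = 2 / real m + 2 / real n"
      using that by (simp add: field_simps)
    finally show ?thesis .
  qed
  have "Cauchy (\<lambda>n. a n / real n)"
  proof (rule CauchyI)
    fix e :: real assume "e > 0"
    then obtain N :: nat where N: "4 / e < real N" using reals_Archimedean2 by blast
    then have "N > 0" using \<open>e > 0\<close>
      by (metis divide_pos_pos gr0I less_asym of_nat_0 zero_less_numeral)
    have small: "2 / real m < e / 2" if "m \<ge> N" for m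
    proof -
      have "4 / e < real m" using N that by linarith
      then show ?thesis using \<open>e > 0\<close> \<open>N > 0\<close> that by (simp add: field_simps)
    qed
    have "norm (a m / real m - a n / real n) < e" if "m \<ge> N" "n \<ge> N" for m n
      using quot[of m n] small[OF that(1)] small[OF that(2)] \<open>N > 0\<close> that by simp
    then show "\<exists>M. \<forall>m\<ge>M. \<forall>n\<ge>M. norm (a m / real m - a n / real n) < e" by blast
  qed
  then obtain \<rho> where \<rho>: "(\<lambda>n. a n / real n) \<longlonglongrightarrow> \<rho>"
    using Cauchy_convergent convergent_def by blast
  have "\<bar>a n - real n * \<rho>\<bar> \<le> 1" for n
  proof (cases "n = 0")
    case True
    then show ?thesis using add[of 0 0] by simp
  next
    case False
    \<comment> \<open>Here \<open>n\<close> is fixed and the limit runs along its multiples; the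
      error \<open>(m + 1) / m\<close> from \<open>mult\<close> tends to 1.\<close>
    have sub: "(\<lambda>m. a (m * n) / real (m * n)) \<longlonglongrightarrow> \<rho>"
      using LIMSEQ_subseq_LIMSEQ[OF \<rho>, of "\<lambda>m. m * n"] False
      by (simp add: o_def strict_mono_def)
    have dev: "(\<lambda>m. \<bar>a n - real n * (a (m * n) / real (m * n))\<bar>) \<longlonglongrightarrow> \<bar>a n - real n * \<rho>\<bar>"
      by (intro tendsto_intros sub)
    have bound: "(\<lambda>m. 1 + 1 / real m) \<longlonglongrightarrow> 1 + 0"
      by (intro tendsto_intros lim_1_over_n)
    have "\<bar>a n - real n * (a (m * n) / real (m * n))\<bar> \<le> 1 + 1 / real m" if "m \<ge> 1" for m
    proof -
      have "\<bar>a n - real n * (a (m * n) / real (m * n))\<bar> = \<bar>a (m * n) - real m * a n\<bar> / real m"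
      proof -
        have "a n - real n * (a (m * n) / real (m * n)) = (real m * a n - a (m * n)) / real m"
          using that False by (simp add: field_simps)
        then show ?thesis by (simp add: abs_minus_commute)
      qed
      also have "\<dots> \<le> (real m + 1) / real m"
        using mult by (intro divide_right_mono) auto
      finally show ?thesis using that by (simp add: field_simps)
    qed
    then show ?thesis using LIMSEQ_le[OF dev bound] by auto
  qed
  then show thesis using that by blast
qed

lemma bounded_deviation_quotient_tendsto:
  fixes a :: "nat \<Rightarrow> real"
  assumes "\<And>t. \<bar>a t - real t * \<rho>\<bar> \<le> C"
  shows "(\<lambda>t. a t / real t) \<longlonglongrightarrow> \<rho>"
proof (rule LIM_zero_cancel, rule Lim_null_comparison)
  show "eventually (\<lambda>t. norm (a t / real t - \<rho>) \<le> C / real t) sequentially"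
    using eventually_gt_at_top[of 0]
  proof eventually_elim
    case (elim t)
    then have "a t / real t - \<rho> = (a t - real t * \<rho>) / real t"
      by (simp add: field_simps)
    then have "norm (a t / real t - \<rho>) = \<bar>a t - real t * \<rho>\<bar> / real t"
      by simp
    also have "\<dots> \<le> C / real t" using assms by (intro divide_right_mono) auto
    finally show ?case .
  qed
  show "(\<lambda>t. C / real t) \<longlonglongrightarrow> 0" by (rule lim_const_over_n)
qed

text \<open>Iterates are again monotone of degree one, so \<open>f ^^ m\<close> displaces
  \<open>(f ^^ n) 0\<close> and 0 by amounts at most 1 apart; hence the orbit of 0 is almost
  additive. One unit of the bound comes from that orbit, the other from moving the starting point to
  \<open>x\<close>. The bound is the same for all maps and times, which is what makes different maps
  comparable; it also shows that the \<open>THE\<close> in \<open>rotation_number\<close> is well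
  defined.\<close>

lemma rotation_number_deviation:
  fixes f :: "real \<Rightarrow> real"
  assumes "mono f" and "\<And>x. f (x + 1) = f x + 1"
  shows "\<bar>(f ^^ t) x - x - real t * rotation_number f\<bar> \<le> 2"
proof -
  have disp: "\<bar>((f ^^ t) x - x) - (f ^^ t) 0\<bar> \<le> 1" for t x
    using mono_degree_one_displacement[of "f ^^ t" x 0]
      degree_one_funpow[of f, OF assms(2)] mono_pow[OF assms(1)] by simp
  have add: "\<bar>(f ^^ (m + n)) 0 - (f ^^ m) 0 - (f ^^ n) 0\<bar> \<le> 1" for m n
    using disp[of m "(f ^^ n) 0"] by (simp add: funpow_add algebra_simps)
  obtain \<rho> where \<rho>: "\<And>n. \<bar>(f ^^ n) 0 - real n * \<rho>\<bar> \<le> 1"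
    using almost_additive_limit[of "\<lambda>t. (f ^^ t) 0", OF add] by blast
  have dev: "\<bar>(f ^^ t) x - x - real t * \<rho>\<bar> \<le> 2" for t x
    using disp[of t x] \<rho>[of t] by linarith
  have "(\<lambda>t. (f ^^ t) x / real t) \<longlonglongrightarrow> \<rho>" for x
  proof (rule bounded_deviation_quotient_tendsto)
    show "\<bar>(f ^^ t) x - real t * \<rho>\<bar> \<le> 2 + \<bar>x\<bar>" for t using dev[of t x] by linarith
  qed
  then have "rotation_number f = \<rho>"
    unfolding rotation_number_def using LIMSEQ_unique by (intro the_equality) blast+
  then show ?thesis using dev by simp
qed

text \<open>Monotonicity replaces uniform convergence: eventually \<open>xs n\<close> lies between
  two fixed points \<open>l\<close> and \<open>r\<close> near \<open>x\<close>, so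
  \<open>g n (xs n)\<close> is squeezed between \<open>g n l\<close> and \<open>g n r\<close>, whose
  limits are close to \<open>f x\<close>.\<close>

lemma mono_tendsto_continuous:
  fixes g :: "nat \<Rightarrow> real \<Rightarrow> real"
  assumes "eventually (\<lambda>n. mono (g n)) sequentially"
    and lim: "\<And>x. (\<lambda>n. g n x) \<longlonglongrightarrow> f x"
    and "isCont f x" and "xs \<longlonglongrightarrow> x"
  shows "(\<lambda>n. g n (xs n)) \<longlonglongrightarrow> f x"
proof (rule tendstoI)
  fix e :: real assume "e > 0"
  then obtain d where "d > 0" and d: "\<And>z. dist z x < d \<Longrightarrow> dist (f z) (f x) < e / 2"
    using assms(3) unfolding continuous_at_eps_delta by (metis half_gt_zero)
  define l r where "l = x - d / 2" and "r = x + d / 2"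
  have lr: "\<bar>f l - f x\<bar> < e / 2" "\<bar>f r - f x\<bar> < e / 2"
    using d[of l] d[of r] \<open>d > 0\<close> by (auto simp: l_def r_def dist_real_def)
  have "eventually (\<lambda>n. dist (g n l) (f l) < e / 2) sequentially"
    "eventually (\<lambda>n. dist (g n r) (f r) < e / 2) sequentially"
    "eventually (\<lambda>n. dist (xs n) x < d / 2) sequentially"
    using tendstoD[OF lim, of "e / 2"] tendstoD[OF assms(4), of "d / 2"] \<open>e > 0\<close> \<open>d > 0\<close> by auto
  with assms(1) show "eventually (\<lambda>n. dist (g n (xs n)) (f x) < e) sequentially"
  proof eventually_elim
    case (elim n)
    then have "l \<le> xs n" "xs n \<le> r"
      unfolding l_def r_def dist_real_def by linarith+
    with elim have "g n l \<le> g n (xs n)" "g n (xs n) \<le> g n r"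
      by (auto intro: monoD)
    then show ?case using elim lr unfolding dist_real_def by linarith
  qed
qed

text \<open>At one fixed large time \<open>t\<close>, the quotient \<open>(f ^^ t) 0 / t\<close>
  approximates the rotation number within \<open>2 / t\<close>, for every map involved. Thus
  convergence of a single iterate suffices.\<close>

lemma rotation_number_tendsto:
  fixes g :: "nat \<Rightarrow> real \<Rightarrow> real"
  assumes mono_g: "eventually (\<lambda>n. mono (g n)) sequentially"
    and deg_g: "eventually (\<lambda>n. \<forall>x. g n (x + 1) = g n x + 1) sequentially"
    and lim: "\<And>x. (\<lambda>n. g n x) \<longlonglongrightarrow> f x"
    and cont: "\<And>x. isCont f x"
    and "mono f" and deg_f: "\<And>x. f (x + 1) = f x + 1"
  shows "(\<lambda>n. rotation_number (g n)) \<longlonglongrightarrow> rotation_number f"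
proof (rule tendstoI)
  fix e :: real assume "e > 0"
  \<comment> \<open>5 = 2 + 2 + 1: two deviations from the rotation numbers, and the distance of the
    two iterates at time \<open>t\<close>.\<close>
  obtain t :: nat where t: "5 / e < real t" using reals_Archimedean2 by blast
  then have "real t > 0" using \<open>e > 0\<close>
    by (smt (verit) divide_pos_pos)
  \<comment> \<open>The point at which \<open>g n\<close> is evaluated moves with \<open>n\<close>,
    so pointwise convergence must be strengthened by \<open>mono_tendsto_continuous\<close>.\<close>
  have iter: "(\<lambda>n. (g n ^^ s) 0) \<longlonglongrightarrow> (f ^^ s) 0" for s
  proof (induction s)
    case (Suc s)
    then show ?case using mono_tendsto_continuous[OF mono_g lim cont] by simp
  qed simp
  have "eventually (\<lambda>n. dist ((g n ^^ t) 0) ((f ^^ t) 0) < 1) sequentially"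
    using tendstoD[OF iter] by simp
  with mono_g deg_g
  show "eventually (\<lambda>n. dist (rotation_number (g n)) (rotation_number f) < e) sequentially"
  proof eventually_elim
    case (elim n)
    have "\<bar>real t * rotation_number (g n) - real t * rotation_number f\<bar> < 5"
      using rotation_number_deviation[of "g n" t 0] rotation_number_deviation[of f t 0] elim assms(5) deg_f
      unfolding dist_real_def by auto
    also have "5 < real t * e" using t \<open>e > 0\<close> by (simp add: field_simps)
    finally have "real t * \<bar>rotation_number (g n) - rotation_number f\<bar> < real t * e"
      using \<open>real t > 0\<close> by (simp add: abs_mult flip: right_diff_distrib)
    then show ?case using \<open>real t > 0\<close> unfolding dist_real_def by simp
  qed
qed

section \<open>The firing dynamics as a circle map\<close>

text \<open>The point \<open>0\<close> is left out because \<^const>\<open>gen_of_config\<close> is uncontrolled there.\<close>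

definition vertex_space :: "real measure" where
  "vertex_space = restrict_space lebesgue {0<..1}"

text \<open>For \<open>c\<close> the firing total before time \<open>t\<close>, the integrand is
  meant to count the firings of \<open>x\<close> up to and including time \<open>t\<close>, so that
  the integral is the next total. For \<open>\<psi>\<close> with values in \<open>[0, 1)\<close>
  this is the lift of a degree-one circle map.\<close>

definition chip_lift :: "(real \<Rightarrow> real) \<Rightarrow> real \<Rightarrow> real" where
  "chip_lift \<psi> c = (\<integral>x. of_int \<lfloor>\<psi> x + c\<rfloor> \<partial>vertex_space)"

lemma space_vertex_space [simp]: "space vertex_space = {0<..1}"
  by (simp add: vertex_space_def space_restrict_space)

lemma measure_vertex_space:
  "A \<subseteq> {0<..1} \<Longrightarrow> measure vertex_space A = measure lebesgue A"
  unfolding vertex_space_def by (simp add: measure_restrict_space)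

lemma finite_measure_vertex_space: "finite_measure vertex_space"
  by (rule finite_measureI) (simp add: vertex_space_def emeasure_restrict_space space_restrict_space)

interpretation vertex_space: finite_measure vertex_space
  by (rule finite_measure_vertex_space)

lemma measure_vertex_space_UNIV: "measure vertex_space {0<..1} = 1"
  by (simp add: measure_vertex_space)

lemma firing_measure_eq_integral:
  assumes [measurable]: "\<eta> \<in> borel_measurable vertex_space"
  shows "firing_measure \<eta> = (\<integral>x. of_bool (\<eta> x \<ge> 1) \<partial>vertex_space)"
proof -
  let ?A = "{x \<in> {0<..1}. \<eta> x \<ge> 1}"
  have "?A \<in> sets vertex_space"
  proof -
    have "{x \<in> space vertex_space. \<eta> x \<ge> 1} \<in> sets vertex_space" by measurable
    then show ?thesis by simp
  qed
  have "?A \<in> sets lebesgue"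
    using \<open>?A \<in> sets vertex_space\<close> unfolding vertex_space_def by (simp add: sets_restrict_space_iff)
  have "firing_measure \<eta> = measure lebesgue ?A"
  \<comment> \<open>\<open>firing_measure\<close> uses the closed interval and
    \<open>vertex_space\<close> the half-open one; they differ by the null set
    \<open>{0}\<close>.\<close>
  proof (cases "\<eta> 0 \<ge> 1")
    case True
    then have "{x \<in> {0..1}. \<eta> x \<ge> 1} = ?A \<union> {0}" by force
    moreover have "measure lebesgue (?A \<union> {0}) = measure lebesgue ?A"
      using \<open>?A \<in> sets lebesgue\<close> by (intro measure_Un_null_set) (auto simp: null_sets_completionI)
    ultimately show ?thesis unfolding firing_measure_def by simp
  next
    case False
    then have "{x \<in> {0..1}. \<eta> x \<ge> 1} = ?A" by (auto simp: order.strict_iff_order)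
    then show ?thesis unfolding firing_measure_def by simp
  qed
  also have "\<dots> = measure vertex_space ?A" by (simp add: measure_vertex_space subset_eq)
  also have "\<dots> = (\<integral>x. indicator ?A x \<partial>vertex_space)"
    using \<open>?A \<in> sets vertex_space\<close> by (simp add: Int_absorb2 subset_eq)
  also have "\<dots> = (\<integral>x. of_bool (\<eta> x \<ge> 1) \<partial>vertex_space)"
    by (intro Bochner_Integration.integral_cong) (auto simp: indicator_def)
  finally show ?thesis .
qed

section \<open>Iterated updates and firing counts\<close>

lemma chip_update_funpow_Suc:
  "(chip_update ^^ Suc t) \<eta> x =
     (chip_update ^^ t) \<eta> x + firing_measure ((chip_update ^^ t) \<eta>)
       - of_bool ((chip_update ^^ t) \<eta> x \<ge> 1)"
  by (simp add: chip_update_def)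

lemma chip_update_funpow_eq:
  "(chip_update ^^ t) \<eta> x =
     \<eta> x + total_firing \<eta> t - (\<Sum>s<t. of_bool ((chip_update ^^ s) \<eta> x \<ge> 1))"
proof (induction t)
  case (Suc t)
  then show ?case
    unfolding chip_update_funpow_Suc total_firing_def sum.lessThan_Suc by linarith
qed (simp add: total_firing_def)

lemma chip_update_funpow_measurable:
  assumes [measurable]: "\<eta> \<in> borel_measurable vertex_space"
  shows "(chip_update ^^ t) \<eta> \<in> borel_measurable vertex_space"
proof (induction t)
  case (Suc t)
  note [measurable] = Suc
  have "(\<lambda>x. (chip_update ^^ t) \<eta> x + firing_measure ((chip_update ^^ t) \<eta>)
       - of_bool ((chip_update ^^ t) \<eta> x \<ge> 1)) \<in> borel_measurable vertex_space"
    by measurable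
  moreover have "(chip_update ^^ Suc t) \<eta> = (\<lambda>x. (chip_update ^^ t) \<eta> x
      + firing_measure ((chip_update ^^ t) \<eta>) - of_bool ((chip_update ^^ t) \<eta> x \<ge> 1))"
    by (rule ext) (rule chip_update_funpow_Suc)
  ultimately show ?case by (simp only:)
qed (simp add: assms)

lemma firing_measure_bounds: "0 \<le> firing_measure \<eta>" "firing_measure \<eta> \<le> 1"
proof -
  show "0 \<le> firing_measure \<eta>" by (simp add: firing_measure_def)
  show "firing_measure \<eta> \<le> 1"
  proof (cases "{x \<in> {0..1}. \<eta> x \<ge> 1} \<in> sets lebesgue")
    case True
    then have "firing_measure \<eta> \<le> measure lebesgue {0..1::real}"
      unfolding firing_measure_def by (intro measure_mono_fmeasurable) auto
    then show ?thesis by simp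
  next
    case False
    \<comment> \<open>A non-measurable set has measure 0 by convention.\<close>
    then show ?thesis by (simp add: firing_measure_def measure_notin_sets)
  qed
qed

text \<open>The interval \<open>[0, 2)\<close> is invariant: after a possible loss of one unit the
  value is in \<open>[0, 1)\<close>, and the gain is at most 1.\<close>

lemma chip_update_funpow_bounds:
  assumes "0 \<le> \<eta> x" "\<eta> x < 2"
  shows "0 \<le> (chip_update ^^ t) \<eta> x \<and> (chip_update ^^ t) \<eta> x < 2"
proof (induction t)
  case (Suc t)
  then show ?case
    using firing_measure_bounds[of "(chip_update ^^ t) \<eta>"]
    unfolding chip_update_funpow_Suc by (auto simp del: funpow.simps split: split_of_bool)
qed (use assms in simp)

text \<open>Let \<open>k\<close> be the number of firings of \<open>x\<close> at times
  \<open>0, ..., t\<close>. Then \<open>\<eta> x + total_firing \<eta> t - k\<close> is the value at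
  time \<open>t\<close> reduced by 1 exactly when \<open>x\<close> fires. As that value is in
  \<open>[0, 2)\<close>, the result is in \<open>[0, 1)\<close>, so \<open>k\<close> is the floor in
  \<open>chip_lift\<close>.\<close>

lemma total_firing_Suc:
  assumes \<eta>: "\<eta> \<in> borel_measurable vertex_space"
    and bounds: "\<And>x. x \<in> {0<..1} \<Longrightarrow> 0 \<le> \<eta> x \<and> \<eta> x < 2"
  shows "total_firing \<eta> (Suc t) = chip_lift \<eta> (total_firing \<eta> t)"
proof -
  note [measurable] = chip_update_funpow_measurable[OF \<eta>]
  have "total_firing \<eta> (Suc t) =
      (\<Sum>s<Suc t. \<integral>x. of_bool ((chip_update ^^ s) \<eta> x \<ge> 1) \<partial>vertex_space)"
    by (simp only: total_firing_def firing_measure_eq_integral[OF chip_update_funpow_measurable[OF \<eta>]])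
  also have "\<dots> = (\<integral>x. (\<Sum>s<Suc t. of_bool ((chip_update ^^ s) \<eta> x \<ge> 1)) \<partial>vertex_space)"
    by (intro Bochner_Integration.integral_sum[symmetric]
        vertex_space.integrable_const_bound[where B = 1]) auto
  also have "\<dots> = chip_lift \<eta> (total_firing \<eta> t)"
    unfolding chip_lift_def
  proof (rule Bochner_Integration.integral_cong[OF refl])
    fix x assume "x \<in> space vertex_space"
    then have "0 \<le> (chip_update ^^ t) \<eta> x \<and> (chip_update ^^ t) \<eta> x < 2"
      using bounds by (intro chip_update_funpow_bounds) auto
    moreover have "(\<Sum>s<Suc t. of_bool ((chip_update ^^ s) \<eta> x \<ge> 1)) \<in> (\<int> :: real set)"
      by (intro Ints_sum) auto
    then obtain k :: int where
      k: "(\<Sum>s<Suc t. of_bool ((chip_update ^^ s) \<eta> x \<ge> 1)) = (of_int k :: real)"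
      by (elim Ints_cases)
    ultimately have "of_int k \<le> \<eta> x + total_firing \<eta> t \<and> \<eta> x + total_firing \<eta> t < of_int k + 1"
      using chip_update_funpow_eq[of t \<eta> x] unfolding sum.lessThan_Suc
      by (cases "(chip_update ^^ t) \<eta> x \<ge> 1") (simp_all only: of_bool_eq; linarith)+
    then have "\<lfloor>\<eta> x + total_firing \<eta> t\<rfloor> = k" by (simp add: floor_eq_iff)
    then show "(\<Sum>s<Suc t. of_bool ((chip_update ^^ s) \<eta> x \<ge> 1)) =
        real_of_int \<lfloor>\<eta> x + total_firing \<eta> t\<rfloor>"
      using k by simp
  qed
  finally show ?thesis .
qed

text \<open>Values below 1 leave room for a shift by \<open>y \<le> 1\<close>: the shifted
  configuration stays in \<open>[0, 2)\<close>, as the firing count requires.\<close>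

locale unit_config =
  fixes \<psi> :: "real \<Rightarrow> real"
  assumes measurable_config [measurable]: "\<psi> \<in> borel_measurable vertex_space"
    and config_bounds: "x \<in> {0<..1} \<Longrightarrow> 0 \<le> \<psi> x \<and> \<psi> x < 1"
begin

lemma chip_lift_integrable: "integrable vertex_space (\<lambda>x. real_of_int \<lfloor>\<psi> x + c\<rfloor>)"
proof (rule vertex_space.integrable_const_bound[where B = "\<bar>c\<bar> + 2"])
  show "AE x in vertex_space. norm (real_of_int \<lfloor>\<psi> x + c\<rfloor>) \<le> \<bar>c\<bar> + 2"
  proof (rule AE_I2)
    fix x assume "x \<in> space vertex_space"
    then have "0 \<le> \<psi> x" "\<psi> x < 1" using config_bounds[of x] by auto
    then show "norm (real_of_int \<lfloor>\<psi> x + c\<rfloor>) \<le> \<bar>c\<bar> + 2"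
      unfolding real_norm_def by linarith
  qed
qed measurable

lemma chip_lift_mono: "mono (chip_lift \<psi>)"
  unfolding chip_lift_def
  by (intro monoI integral_mono chip_lift_integrable) (simp add: floor_mono)

lemma chip_lift_degree_one: "chip_lift \<psi> (c + 1) = chip_lift \<psi> c + 1"
proof -
  have "chip_lift \<psi> (c + 1) = (\<integral>x. real_of_int \<lfloor>\<psi> x + c\<rfloor> + 1 \<partial>vertex_space)"
    unfolding chip_lift_def by (simp flip: add.assoc)
  also have "\<dots> = chip_lift \<psi> c + 1"
    unfolding chip_lift_def
    by (subst Bochner_Integration.integral_add)
       (auto intro: chip_lift_integrable simp: measure_vertex_space_UNIV)
  finally show ?thesis .
qed

text \<open>Put \<open>s = \<lceil>c\<rceil> - c\<close>. Then
  \<open>\<psi> x + c = \<lceil>c\<rceil> + (\<psi> x - s)\<close> with \<open>\<psi> x - s\<close>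
  in \<open>(-1, 1)\<close>, so the floor drops to \<open>\<lceil>c\<rceil> - 1\<close> exactly
  where \<open>\<psi> x < s\<close>. This is the formula of \<open>lift_map\<close> with the
  distribution function of \<open>\<psi>\<close> in the role of \<open>F\<close>.\<close>

lemma chip_lift_eq:
  "chip_lift \<psi> c =
     of_int \<lceil>c\<rceil> - measure lebesgue {x \<in> {0<..1}. \<psi> x < of_int \<lceil>c\<rceil> - c}"
proof -
  let ?A = "{x \<in> {0<..1}. \<psi> x < of_int \<lceil>c\<rceil> - c}"
  have A: "?A \<in> sets vertex_space"
  proof -
    have "{x \<in> space vertex_space. \<psi> x < of_int \<lceil>c\<rceil> - c} \<in> sets vertex_space" by measurable
    then show ?thesis by simp
  qed
  have "chip_lift \<psi> c = (\<integral>x. real_of_int \<lceil>c\<rceil> - indicator ?A x \<partial>vertex_space)"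
    unfolding chip_lift_def
  proof (rule Bochner_Integration.integral_cong[OF refl])
    fix x assume x: "x \<in> space vertex_space"
    then have "0 \<le> \<psi> x" "\<psi> x < 1" using config_bounds[of x] by auto
    then have "\<lfloor>\<psi> x + c\<rfloor> = (if \<psi> x < of_int \<lceil>c\<rceil> - c then \<lceil>c\<rceil> - 1 else \<lceil>c\<rceil>)"
      by (auto simp: floor_eq_iff) linarith+
    then show "real_of_int \<lfloor>\<psi> x + c\<rfloor> = real_of_int \<lceil>c\<rceil> - indicator ?A x"
      using x by (auto simp: indicator_def)
  qed
  also have "\<dots> = of_int \<lceil>c\<rceil> - measure vertex_space ?A"
    using A by (subst Bochner_Integration.integral_diff)
      (auto simp: measure_vertex_space_UNIV less_top[symmetric] Int_absorb2 subset_eq)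
  also have "measure vertex_space ?A = measure lebesgue ?A"
    by (intro measure_vertex_space) auto
  finally show ?thesis .
qed

text \<open>The shift moves from the configuration to the argument: the lift of
  \<open>\<psi> + y\<close> at \<open>c\<close> is the lift of \<open>\<psi>\<close> at
  \<open>y + c\<close>. Hence the orbit starts at \<open>y\<close>, matching firing total 0.\<close>

lemma total_firing_orbit:
  assumes "y \<in> {0..1}"
  shows "((translation y \<circ> chip_lift \<psi>) ^^ t) y = y + total_firing (\<lambda>x. \<psi> x + y) t"
proof (induction t)
  case (Suc t)
  have "total_firing (\<lambda>x. \<psi> x + y) (Suc t) = chip_lift (\<lambda>x. \<psi> x + y) (total_firing (\<lambda>x. \<psi> x + y) t)"
    using config_bounds assms by (intro total_firing_Suc) fastforce+
  then show ?case using Suc by (simp add: chip_lift_def translation_def add.assoc)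
qed (simp add: total_firing_def)

lemma activity_eq_rotation_number:
  assumes "y \<in> {0..1}"
  shows "activity (\<lambda>x. \<psi> x + y) = rotation_number (translation y \<circ> chip_lift \<psi>)"
proof -
  let ?f = "translation y \<circ> chip_lift \<psi>"
  have "mono ?f" using chip_lift_mono by (simp add: mono_def translation_def)
  moreover have "?f (x + 1) = ?f x + 1" for x
    by (simp add: translation_def chip_lift_degree_one)
  ultimately have "\<bar>total_firing (\<lambda>x. \<psi> x + y) t - real t * rotation_number ?f\<bar> \<le> 2" for t
    using rotation_number_deviation[of ?f t y] unfolding total_firing_orbit[OF assms] by simp
  then show ?thesis
    unfolding activity_def by (intro limI bounded_deviation_quotient_tendsto)
qed

end

section \<open>Configurations on complete graphs\<close>

lemma ceiling_mem_vertices: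
  assumes "n \<ge> 1" "x \<in> {0<..1}"
  shows "nat \<lceil>real n * x\<rceil> \<in> {1..n}"
proof -
  have "0 < real n * x" "real n * x \<le> real n"
    using assms by (auto simp: mult_le_cancel_left1)
  then show ?thesis by (simp add: nat_le_iff ceiling_le_iff) linarith
qed

lemma unit_config_gen_of_config:
  assumes "n \<ge> 1" and \<sigma>: "\<And>v. v \<in> {1..n} \<Longrightarrow> \<sigma> v \<le> n - 1"
  shows "unit_config (gen_of_config n \<sigma>)"
proof
  have "(\<lambda>x. real (\<sigma> (nat \<lceil>real n * x\<rceil>))) \<in> borel_measurable borel"
    by measurable
  then have "gen_of_config n \<sigma> \<in> borel_measurable borel"
    unfolding gen_of_config_def[abs_def] by measurable
  then show "gen_of_config n \<sigma> \<in> borel_measurable vertex_space"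
    unfolding vertex_space_def
    by (intro measurable_restrict_space1 measurable_completion) simp
next
  fix x :: real assume "x \<in> {0<..1}"
  then have "\<sigma> (nat \<lceil>real n * x\<rceil>) \<le> n - 1"
    using ceiling_mem_vertices[OF assms(1)] \<sigma> by blast
  \<comment> \<open>The integer gap below \<open>n\<close> leaves room for the ceiling excess, which
    is less than 1.\<close>
  then have "real (\<sigma> (nat \<lceil>real n * x\<rceil>)) \<le> real n - 1" using assms(1) by linarith
  moreover have "0 \<le> real_of_int \<lceil>real n * x\<rceil> - real n * x" "real_of_int \<lceil>real n * x\<rceil> - real n * x < 1"
    by linarith+
  moreover have "0 \<le> real (\<sigma> (nat \<lceil>real n * x\<rceil>))" by simp
  ultimately have "0 \<le> real (\<sigma> (nat \<lceil>real n * x\<rceil>)) + real_of_int \<lceil>real n * x\<rceil> - real n * x"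
    "real (\<sigma> (nat \<lceil>real n * x\<rceil>)) + real_of_int \<lceil>real n * x\<rceil> - real n * x < real n"
    by linarith+
  then show "0 \<le> gen_of_config n \<sigma> x \<and> gen_of_config n \<sigma> x < 1"
    using assms(1) by (simp add: gen_of_config_def)
qed

text \<open>Vertex \<open>v\<close> occupies the interval \<open>((v - 1) / n, v / n]\<close> of
  length \<open>1 / n\<close>, and these intervals are disjoint. This translates vertex counts into
  Lebesgue measure.\<close>

lemma measure_ceiling_vertices:
  assumes "n \<ge> 1" "V \<subseteq> {1..n}"
  shows "{x \<in> {0<..1}. nat \<lceil>real n * x\<rceil> \<in> V} \<in> lmeasurable"
    and "measure lebesgue {x \<in> {0<..1}. nat \<lceil>real n * x\<rceil> \<in> V} = real (card V) / real n"
proof -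
  define I where "I v = {(real v - 1) / real n <.. real v / real n}" for v
  have mem: "x \<in> I v \<longleftrightarrow> \<lceil>real n * x\<rceil> = int v" for x v
    using assms(1) by (auto simp: I_def ceiling_eq_iff field_simps)
  have eq: "{x \<in> {0<..1}. nat \<lceil>real n * x\<rceil> \<in> V} = (\<Union>v\<in>V. I v)"
  proof (intro equalityI subsetI)
    fix x assume "x \<in> (\<Union>v\<in>V. I v)"
    then obtain v where v: "v \<in> V" "x \<in> I v" by blast
    then have "1 \<le> v" "v \<le> n" using assms(2) by auto
    then have "0 \<le> (real v - 1) / real n" "real v / real n \<le> 1" by auto
    then have "x \<in> {0<..1}" using v(2) unfolding I_def by auto
    then show "x \<in> {x \<in> {0<..1}. nat \<lceil>real n * x\<rceil> \<in> V}" using v mem by auto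
  next
    fix x assume x: "x \<in> {x \<in> {0<..1}. nat \<lceil>real n * x\<rceil> \<in> V}"
    then have "nat \<lceil>real n * x\<rceil> \<ge> 1"
      using ceiling_mem_vertices[OF assms(1), of x] by (simp del: One_nat_def)
    then have "\<lceil>real n * x\<rceil> = int (nat \<lceil>real n * x\<rceil>)" by linarith
    then show "x \<in> (\<Union>v\<in>V. I v)" using x mem by blast
  qed
  have "I v \<in> lmeasurable" for v
    unfolding I_def by (rule fmeasurableI2[of "{(real v - 1) / real n..real v / real n}"]) auto
  moreover have "measure lebesgue (I v) = 1 / real n" for v
    using assms(1) by (simp add: I_def divide_right_mono flip: diff_divide_distrib)
  ultimately have I: "I v \<in> lmeasurable" "measure lebesgue (I v) = 1 / real n" for v by auto
  have "finite V" using assms(2) finite_subset by blast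
  show "{x \<in> {0<..1}. nat \<lceil>real n * x\<rceil> \<in> V} \<in> lmeasurable"
    unfolding eq using I(1) \<open>finite V\<close> by (intro fmeasurable.finite_UN) auto
  have "disjoint_family_on I V"
    by (auto simp: disjoint_family_on_def mem)
  then have "measure lebesgue (\<Union>v\<in>V. I v) = (\<Sum>v\<in>V. measure lebesgue (I v))"
    using I(1) \<open>finite V\<close> by (intro measure_finite_Union) (auto simp: fmeasurableD fmeasurableD2 simp del: emeasure_completion)
  then show "measure lebesgue {x \<in> {0<..1}. nat \<lceil>real n * x\<rceil> \<in> V} = real (card V) / real n"
    unfolding eq using I(2) by simp
qed

text \<open>On the interval of vertex \<open>v\<close> the configuration lies in
  \<open>[\<sigma> v / n, (\<sigma> v + 1) / n)\<close>. So its sublevel set at \<open>s\<close>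
  contains the intervals of all \<open>v\<close> with \<open>\<sigma> v < n * s - 1\<close> and only
  meets those with \<open>\<sigma> v < n * s\<close>.\<close>

lemma measure_gen_of_config_less:
  assumes "n \<ge> 1" and \<sigma>: "\<And>v. v \<in> {1..n} \<Longrightarrow> \<sigma> v \<le> n - 1"
  defines "H \<equiv> \<lambda>x. real (card {v \<in> {1..n}. real (\<sigma> v) < real n * x}) / real n"
  shows "measure lebesgue {x \<in> {0<..1}. gen_of_config n \<sigma> x < s} \<in> {H (s - 1 / real n)..H s}"
proof -
  define V where "V z = {v \<in> {1..n}. real (\<sigma> v) < real n * z}" for z
  define B where "B z = {x \<in> {0<..1}. nat \<lceil>real n * x\<rceil> \<in> V z}" for z
  let ?A = "{x \<in> {0<..1}. gen_of_config n \<sigma> x < s}"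
  interpret unit_config "gen_of_config n \<sigma>"
    using assms(1,2) by (rule unit_config_gen_of_config)
  have V: "V z \<subseteq> {1..n}" for z by (auto simp: V_def)
  have B: "B z \<in> lmeasurable" "measure lebesgue (B z) = H z" for z
    using measure_ceiling_vertices[OF assms(1) V[of z]] by (simp_all add: B_def H_def V_def)
  have "{x \<in> space vertex_space. gen_of_config n \<sigma> x < s} \<in> sets vertex_space" by measurable
  then have A: "?A \<in> sets lebesgue"
    unfolding vertex_space_def by (simp add: sets_restrict_space_iff space_restrict_space)
  have frac: "0 \<le> real_of_int \<lceil>real n * x\<rceil> - real n * x" "real_of_int \<lceil>real n * x\<rceil> - real n * x < 1"
    for x by linarith+
  have less_iff: "gen_of_config n \<sigma> x < s \<longleftrightarrow>
      real (\<sigma> (nat \<lceil>real n * x\<rceil>)) + (real_of_int \<lceil>real n * x\<rceil> - real n * x) < real n * s" for x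
    using assms(1) by (simp add: gen_of_config_def field_simps)
  have "?A \<subseteq> B s"
  proof
    fix x assume x: "x \<in> ?A"
    then have "real (\<sigma> (nat \<lceil>real n * x\<rceil>)) < real n * s"
      using frac(1)[of x] unfolding mem_Collect_eq less_iff by linarith
    then show "x \<in> B s"
      using x ceiling_mem_vertices[OF assms(1), of x] by (simp add: B_def V_def)
  qed
  moreover have "B (s - 1 / real n) \<subseteq> ?A"
  proof
    fix x assume x: "x \<in> B (s - 1 / real n)"
    then have "real (\<sigma> (nat \<lceil>real n * x\<rceil>)) < real n * s - 1"
      using assms(1) by (simp add: B_def V_def right_diff_distrib)
    then have "gen_of_config n \<sigma> x < s" unfolding less_iff using frac(2)[of x] by linarith
    then show "x \<in> ?A" using x by (simp add: B_def)
  qed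
  moreover have "?A \<in> lmeasurable"
    using fmeasurableI2[OF B(1) \<open>?A \<subseteq> B s\<close> A] .
  ultimately have "measure lebesgue (B (s - 1 / real n)) \<le> measure lebesgue ?A"
    "measure lebesgue ?A \<le> measure lebesgue (B s)"
    using A B(1) by (auto intro!: measure_mono_fmeasurable dest: fmeasurableD)
  then show ?thesis using B(2) by simp
qed

text \<open>Only integers \<open>k\<close> are delicate. The left branch
  \<open>k - F (k - z)\<close> and the right branch \<open>k + 1 - F (k + 1 - z)\<close> both tend
  to \<open>k\<close> there, because \<open>F 0 = 0\<close> and \<open>F 1 = 1\<close>.\<close>

lemma lift_map_isCont:
  assumes F: "continuous_on {0..1} F" and "F 0 = 0" "F 1 = 1"
  shows "isCont (lift_map F) x"
proof -
  define G where "G z = F (max 0 (min 1 z))" for z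
  have "continuous_on UNIV G"
    unfolding G_def by (intro continuous_on_compose2[OF F] continuous_intros) auto
  then have contG: "continuous_on S (\<lambda>z. G (g z))" if "continuous_on S g" for S and g :: "real \<Rightarrow> real"
    using continuous_on_compose2[of UNIV G S g] that by auto
  define k where "k = \<lfloor>x\<rfloor>"
  let ?J = "{real_of_int k - 1<..<real_of_int k + 1}"
  text \<open>Near the integer \<open>k\<close> only one of the two \<open>G\<close>-terms is not yet saturated at \<open>0\<close> or \<open>1\<close>.\<close>
  have eq: "lift_map F z = of_int k + 1 - G (of_int k - z) - G (of_int k + 1 - z)" if "z \<in> ?J" for z
  proof (cases "z \<le> of_int k")
    case True
    then have "\<lceil>z\<rceil> = k" using that by (simp add: ceiling_eq_iff)
    then show ?thesis using True that assms by (simp add: lift_map_def G_def)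
  next
    case False
    then have "\<lceil>z\<rceil> = k + 1" using that by (simp add: ceiling_eq_iff)
    then show ?thesis using False that assms by (simp add: lift_map_def G_def)
  qed
  have "continuous_on ?J (\<lambda>z. of_int k + 1 - G (of_int k - z) - G (of_int k + 1 - z))"
    by (intro continuous_intros contG)
  then have "continuous_on ?J (lift_map F)"
    by (rule continuous_on_eq) (simp add: eq)
  moreover have "x \<in> ?J" unfolding k_def by (simp, linarith)
  ultimately show ?thesis by (simp add: continuous_on_eq_continuous_at)
qed

lemma lift_map_degree_one: "lift_map F (x + 1) = lift_map F x + 1"
  by (simp add: lift_map_def)

section \<open>Passing to the limit of the lifts\<close>

theorem theorem3p1:
  fixes \<sigma> :: "nat \<Rightarrow> nat \<Rightarrow> nat" and F :: "real \<Rightarrow> real"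
  assumes "\<And>n v. n \<ge> 2 \<Longrightarrow> v \<in> {1..n} \<Longrightarrow> \<sigma> n v \<le> n - 1"
    and "continuous_on {0..1} F"
    and "\<And>x. x \<in> {0..1} \<Longrightarrow> F x \<in> {0..1}"
    and "\<And>x. x \<in> {0..1} \<Longrightarrow>
      (\<lambda>n. real (card {v \<in> {1..n}. real (\<sigma> n v) < real n * x}) / real n) \<longlonglongrightarrow> F x"
  shows "\<forall>y\<in>{0..1}.
    (\<lambda>n. activity_diagram n (\<sigma> n) y) \<longlonglongrightarrow> rotation_number (translation y \<circ> lift_map F)"
proof
  fix y :: real assume y: "y \<in> {0..1}"
  define H where "H n x = real (card {v \<in> {1..n}. real (\<sigma> n v) < real n * x}) / real n" for n x
  \<comment> \<open>Constant extension of \<open>F\<close> to the line, so that arguments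
    \<open>s - 1 / n\<close> below 0 cause no trouble.\<close>
  define G where "G z = F (max 0 (min 1 z))" for z
  define L where "L n = chip_lift (gen_of_config n (\<sigma> n))" for n
  have config: "unit_config (gen_of_config n (\<sigma> n))" if "n \<ge> 2" for n
    using that assms(1) by (intro unit_config_gen_of_config) auto
  have H_low: "H n x = 0" if "x \<le> 0" for n x
  proof -
    have "real n * x \<le> 0" using that by (simp add: mult_nonneg_nonpos)
    then have "{v \<in> {1..n}. real (\<sigma> n v) < real n * x} = {}"
      by (auto simp: not_less intro: order_trans)
    then show ?thesis by (simp add: H_def)
  qed
  have H_high: "H n x = 1" if "x \<ge> 1" "n \<ge> 2" for n x
  proof -
    have "real (\<sigma> n v) < real n * x" if "v \<in> {1..n}" for v
    proof -
      have "real (\<sigma> n v) < real n" using assms(1)[OF \<open>n \<ge> 2\<close> that] \<open>n \<ge> 2\<close> by simp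
      also have "\<dots> \<le> real n * x" using \<open>x \<ge> 1\<close> by (simp add: mult_le_cancel_left1)
      finally show ?thesis .
    qed
    then have "{v \<in> {1..n}. real (\<sigma> n v) < real n * x} = {1..n}" by auto
    then show ?thesis using that by (simp add: H_def)
  qed
  have lim_01: "(\<lambda>n. H n x) \<longlonglongrightarrow> F x" if "x \<in> {0..1}" for x
    using assms(4)[OF that] by (simp add: H_def)
  have H_high': "(\<lambda>n. H n x) \<longlonglongrightarrow> 1" if "x \<ge> 1" for x
    by (rule tendsto_eventually) (use H_high that in \<open>auto intro!: eventually_sequentiallyI[of 2]\<close>)
  \<comment> \<open>The boundary values are forced: no vertex has fewer than 0 chips, and for
    \<open>n \<ge> 2\<close> every vertex has fewer than \<open>n\<close>.\<close>
  have F0: "F 0 = 0" using LIMSEQ_unique[OF lim_01[of 0]] H_low by simp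
  have F1: "F 1 = 1" using LIMSEQ_unique[OF lim_01[of 1] H_high'] by simp
  have H_lim: "(\<lambda>n. H n x) \<longlonglongrightarrow> G x" for x
  proof -
    consider "x \<le> 0" | "x \<in> {0..1}" | "x \<ge> 1" by force
    then show ?thesis
      by cases (use H_low H_high' lim_01 F0 F1 in \<open>auto simp: G_def\<close>)
  qed
  have "mono (H n)" for n
    unfolding H_def
    by (intro monoI divide_right_mono of_nat_mono card_mono)
       (auto intro: order_less_le_trans mult_left_mono)
  have "continuous_on UNIV G"
    unfolding G_def by (intro continuous_on_compose2[OF assms(2)] continuous_intros) auto
  \<comment> \<open>The lower bound for the sublevel measure is taken at a moving argument; monotone
    \<open>H n\<close> and continuous \<open>G\<close> absorb the shift.\<close>
  have H_shift_lim: "(\<lambda>n. H n (s - 1 / real n)) \<longlonglongrightarrow> G s" for s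
  proof (rule mono_tendsto_continuous[OF _ H_lim])
    show "(\<lambda>n. s - 1 / real n) \<longlonglongrightarrow> s"
      using tendsto_diff[OF tendsto_const lim_1_over_n, of s] by simp
    show "isCont G s" using \<open>continuous_on UNIV G\<close> by (simp add: continuous_on_eq_continuous_at)
  qed (use \<open>\<And>n. mono (H n)\<close> in simp)
  have measure_lim: "(\<lambda>n. measure lebesgue {x \<in> {0<..1}. gen_of_config n (\<sigma> n) x < s}) \<longlonglongrightarrow> G s" for s
  proof (rule tendsto_sandwich[OF _ _ H_shift_lim H_lim])
    have "measure lebesgue {x \<in> {0<..1}. gen_of_config n (\<sigma> n) x < s} \<in> {H n (s - 1 / real n)..H n s}"
      if "n \<ge> 2" for n
      unfolding H_def using that assms(1) by (intro measure_gen_of_config_less) auto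
    then show
      "eventually (\<lambda>n. H n (s - 1 / real n) \<le>
         measure lebesgue {x \<in> {0<..1}. gen_of_config n (\<sigma> n) x < s}) sequentially"
      "eventually (\<lambda>n. measure lebesgue {x \<in> {0<..1}. gen_of_config n (\<sigma> n) x < s} \<le> H n s) sequentially"
      by (auto intro!: eventually_sequentiallyI[of 2])
  qed
  have L_lim: "(\<lambda>n. L n c) \<longlonglongrightarrow> lift_map F c" for c
  proof -
    have "G (of_int \<lceil>c\<rceil> - c) = F (of_int \<lceil>c\<rceil> - c)"
    proof -
      have "0 \<le> of_int \<lceil>c\<rceil> - c" "of_int \<lceil>c\<rceil> - c \<le> 1" by linarith+
      then show ?thesis by (simp add: G_def)
    qed
    then have "(\<lambda>n. of_int \<lceil>c\<rceil> - measure lebesgue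
        {x \<in> {0<..1}. gen_of_config n (\<sigma> n) x < of_int \<lceil>c\<rceil> - c}) \<longlonglongrightarrow> lift_map F c"
      unfolding lift_map_def using measure_lim[of "of_int \<lceil>c\<rceil> - c"] by (intro tendsto_intros) simp
    then show ?thesis
      by (rule Lim_transform_eventually)
         (auto intro!: eventually_sequentiallyI[of 2] simp: L_def unit_config.chip_lift_eq[OF config])
  qed
  have mono_L: "mono (L n)" if "n \<ge> 2" for n
    using unit_config.chip_lift_mono[OF config[OF that]] by (simp add: L_def)
  \<comment> \<open>Monotonicity is inherited from the lifts \<open>L n\<close> through their
    pointwise limit.\<close>
  have "mono (lift_map F)"
  proof (rule monoI)
    fix a b :: real assume "a \<le> b"
    then show "lift_map F a \<le> lift_map F b"
      using mono_L by (intro LIMSEQ_le[OF L_lim L_lim]) (auto dest: monoD)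
  qed
  have "(\<lambda>n. rotation_number (translation y \<circ> L n)) \<longlonglongrightarrow> rotation_number (translation y \<circ> lift_map F)"
  proof (rule rotation_number_tendsto)
    show "eventually (\<lambda>n. mono (translation y \<circ> L n)) sequentially"
      using mono_L by (auto intro!: eventually_sequentiallyI[of 2] simp: mono_def translation_def)
    show "eventually (\<lambda>n. \<forall>x. (translation y \<circ> L n) (x + 1) = (translation y \<circ> L n) x + 1) sequentially"
      by (auto intro!: eventually_sequentiallyI[of 2]
          simp: L_def translation_def unit_config.chip_lift_degree_one[OF config])
    show "(\<lambda>n. (translation y \<circ> L n) x) \<longlonglongrightarrow> (translation y \<circ> lift_map F) x" for x
      unfolding translation_def o_apply by (intro tendsto_intros L_lim)
    show "isCont (translation y \<circ> lift_map F) x" for x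
      unfolding translation_def[abs_def] o_def
      by (intro continuous_intros lift_map_isCont assms(2) F0 F1)
    show "mono (translation y \<circ> lift_map F)"
      using \<open>mono (lift_map F)\<close> by (simp add: mono_def translation_def)
    show "(translation y \<circ> lift_map F) (x + 1) = (translation y \<circ> lift_map F) x + 1" for x
      by (simp add: translation_def lift_map_degree_one)
  qed
  then show "(\<lambda>n. activity_diagram n (\<sigma> n) y) \<longlonglongrightarrow> rotation_number (translation y \<circ> lift_map F)"
    by (rule Lim_transform_eventually)
       (auto intro!: eventually_sequentiallyI[of 2]
         simp: activity_diagram_def L_def unit_config.activity_eq_rotation_number[OF config y])
qed

end
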